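(* Let $h$ be a positive integer and let $A_1,\ldots,A_h\subseteq\mathbb{Z}^+$. Let $\tau_1,\ldots,\tau_h\in(0,1)$ be such that $\sum_{i=1}^h\tau_i=1$, and assume that $$\limsup_{x\to\infty}A_i(x)\frac{(\log x)^{1-\tau_i}}{x}<\infty$$ for all $1\le i\le h$. Then $$\left(\liminf_{x\to\infty}\frac{\sum_{n\le x}S_{A_1,\ldots,A_h}(n)}{x}\right)\prod_{i=1}^h\frac{1}{\Gamma(\tau_i)}\ \le\ \prod_{i=1}^h\limsup_{x\to\infty}A_i(x)\frac{(\log x)^{1-\tau_i}}{x}.$$
   Context: $\mathbb{Z}^+$ denotes the set of positive integers, $\log$ the natural logarithm, and $\Gamma$ the Euler gamma function. For $A\subseteq\mathbb{Z}^+$, the counting function is $A(x)=|\{a\in A:a\le x\}|$. For $A_1,\ldots,A_h\subseteq\mathbb{Z}^+$ and $n\in\mathbb{Z}^+$, the common multiplicative representation function is $$S_{A_1,\ldots,A_h}(n)=|\{(a_1,\ldots,a_h): a_i\in A_i \text{ for all } i,\ a_1\cdots a_h=n\}|.$$ *)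

theory Defs
  imports "HOL-Analysis.Analysis"
begin

definition counting :: "nat set \<Rightarrow> real \<Rightarrow> nat" where
  "counting A x = card {a \<in> A. real a \<le> x}"

text \<open>Tuples \<open>(a_1, \<dots>, a_h)\<close> are encoded as extensional functions on \<open>{1..h}\<close>. For sets of
  positive integers and positive \<open>n\<close> there are only finitely many tuples with product \<open>n\<close>, so
  the cardinality is the true one.\<close>

definition mult_rep :: "nat \<Rightarrow> (nat \<Rightarrow> nat set) \<Rightarrow> nat \<Rightarrow> nat" where
  "mult_rep h A n = card {a \<in> Pi\<^sub>E {1..h} A. (\<Prod>i = 1..h. a i) = n}"

text \<open>The upper limit, over real \<open>x\<close>, is taken in the extended reals, so it always exists.\<close>

definition scaled_upper_limit :: "nat set \<Rightarrow> real \<Rightarrow> ereal" where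
  "scaled_upper_limit A \<tau> =
     Limsup at_top (\<lambda>x::real. ereal (real (counting A x) * (ln x powr (1 - \<tau>) / x)))"

end

theory Submission imports Defs "HOL-Real_Asymp.Real_Asymp" begin

text \<open>The Dirichlet series of \<open>S\<close> is the product of the Dirichlet series of the \<open>A\<^sub>i\<close>, so both sides
  can be compared at \<open>s = 1 + \<sigma>\<close> as \<open>\<sigma> \<rightarrow> 0\<close>. Partial summation in the variable \<open>u = ln x\<close> gives
  \<open>\<Sum> f n / n powr s = \<integral> s exp (- s u) (\<Sum>n \<le> exp u. f n) du\<close>. If \<open>A\<^sub>i(x) \<le> D\<^sub>i x (log x) powr (\<tau>\<^sub>i - 1)\<close>
  for large \<open>x\<close>, the integral for \<open>A\<^sub>i\<close> is at most \<open>O(1) + s D\<^sub>i \<Gamma>(\<tau>\<^sub>i) \<sigma> powr (-\<tau>\<^sub>i)\<close>; if the sum of \<open>S\<close>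
  up to \<open>x\<close> is at least \<open>K x\<close> for large \<open>x\<close>, the integral for \<open>S\<close> is at least \<open>s K / \<sigma> - O(1)\<close>.
  Since the \<open>\<tau>\<^sub>i\<close> sum to \<open>1\<close>, multiplying by \<open>\<sigma>\<close> and letting \<open>\<sigma> \<rightarrow> 0\<close> gives \<open>K \<le> \<Prod> D\<^sub>i \<Gamma>(\<tau>\<^sub>i)\<close>.\<close>

section \<open>Two integrals over the half-line \<open>u \<ge> 0\<close>\<close>

text \<open>Substitute \<open>\<sigma> * u\<close> for the variable in Euler's integral. Working
  with nonnegative integrals in \<open>ennreal\<close> yields integrability together with the
  value.\<close>

lemma Gamma_integral_scaled:
  fixes \<sigma> t :: real
  assumes "\<sigma> > 0" "t > 0"
  shows "((\<lambda>u. u powr (t - 1) * exp (- \<sigma> * u)) has_integral Gamma t * \<sigma> powr - t) {0..}"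
proof -
  let ?g = "\<lambda>u. indicator {0..} u * u powr (t - 1) / exp u :: real"
  let ?f = "\<lambda>u. if u \<in> {0..} then u powr (t - 1) * exp (- \<sigma> * u) else 0 :: real"
  have g_scale: "?g (0 + \<sigma> * u) = \<sigma> powr (t - 1) * ?f u" for u
    using assms by (auto simp: indicator_def powr_mult exp_minus field_simps zero_le_mult_iff)
  have f_meas: "?f \<in> borel_measurable borel"
    by measurable
  have "ennreal (Gamma t) = (\<integral>\<^sup>+u. ennreal (?g u) \<partial>lborel)"
    using Gamma_conv_nn_integral_real[OF assms(2)] .
  also have "\<dots> = \<bar>\<sigma>\<bar> * (\<integral>\<^sup>+u. ennreal (?g (0 + \<sigma> * u)) \<partial>lborel)"
    using assms by (intro nn_integral_real_affine) auto
  also have "\<dots> = \<bar>\<sigma>\<bar> * (\<integral>\<^sup>+u. ennreal (\<sigma> powr (t - 1)) * ennreal (?f u) \<partial>lborel)"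
    unfolding g_scale by (subst ennreal_mult') auto
  also have "\<dots> = \<bar>\<sigma>\<bar> * (ennreal (\<sigma> powr (t - 1)) * (\<integral>\<^sup>+u. ennreal (?f u) \<partial>lborel))"
    using f_meas by (subst nn_integral_cmult) auto
  also have "\<dots> = ennreal (\<sigma> powr t) * (\<integral>\<^sup>+u. ennreal (?f u) \<partial>lborel)"
    using assms by (simp add: mult.assoc[symmetric] ennreal_mult'[symmetric] powr_diff)
  finally have eq: "ennreal (Gamma t) = ennreal (\<sigma> powr t) * (\<integral>\<^sup>+u. ennreal (?f u) \<partial>lborel)" .
  \<comment> \<open>The factor inserted here equals 1. It isolates the integral without a division
    in \<open>ennreal\<close>, before the integral is known to be finite.\<close>
  have "(\<integral>\<^sup>+u. ennreal (?f u) \<partial>lborel)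
      = ennreal (\<sigma> powr - t * \<sigma> powr t) * (\<integral>\<^sup>+u. ennreal (?f u) \<partial>lborel)"
    using assms by (simp add: powr_minus)
  also have "\<dots> = ennreal (\<sigma> powr - t) * ennreal (Gamma t)"
    unfolding eq by (simp add: ennreal_mult' mult.assoc)
  also have "\<dots> = ennreal (Gamma t * \<sigma> powr - t)"
    using Gamma_real_pos[OF assms(2)] by (simp add: ennreal_mult mult.commute)
  finally have "(?f has_integral Gamma t * \<sigma> powr - t) UNIV"
    using f_meas Gamma_real_pos[OF assms(2)] by (intro nn_integral_has_integral) auto
  then show ?thesis
    by (subst (asm) has_integral_restrict) auto
qed

text \<open>For a single \<open>n\<close>, the value \<open>n powr - s\<close> is the integral of
  \<open>s * exp (- s * u)\<close> over the ray \<open>u \<ge> ln n\<close>, which lies in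
  \<open>{0..}\<close> because \<open>n \<ge> 1\<close>. Since \<open>I\<close> is finite, sum and
  integral may be exchanged freely.\<close>

lemma partial_summation_has_integral:
  fixes f :: "nat \<Rightarrow> real" and s :: real
  assumes "s > 0" "finite I" "0 \<notin> I"
  shows "((\<lambda>u. s * exp (- s * u) * (\<Sum>n | n \<in> I \<and> ln (real n) \<le> u. f n))
           has_integral (\<Sum>n\<in>I. f n * real n powr - s)) {0..}"
proof -
  have "((\<lambda>u. if u \<in> {ln (real n)..} then f n * s * exp (- s * u) else 0)
          has_integral f n * real n powr - s) {0..}" if "n \<in> I" for n
  proof -
    from that assms have "n > 0" by (metis gr0I)
    have "((\<lambda>u. f n * s * exp (- s * u)) has_integral f n * s * (exp (- s * ln (real n)) / s)) {ln (real n)..}"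
      using assms by (intro has_integral_mult_right has_integral_exp_minus_to_infinity)
    then show ?thesis
      using \<open>n > 0\<close> assms by (subst has_integral_restrict) (auto simp: powr_def)
  qed
  from has_integral_sum[OF assms(2) this]
  have "((\<lambda>u. \<Sum>n\<in>I. if u \<in> {ln (real n)..} then f n * s * exp (- s * u) else 0)
          has_integral (\<Sum>n\<in>I. f n * real n powr - s)) {0..}" .
  also have "(\<lambda>u. \<Sum>n\<in>I. if u \<in> {ln (real n)..} then f n * s * exp (- s * u) else 0)
           = (\<lambda>u. s * exp (- s * u) * (\<Sum>n | n \<in> I \<and> ln (real n) \<le> u. f n))"
    using assms(2)
    by (auto simp: fun_eq_iff sum_distrib_left sum.inter_filter ac_simps intro!: sum.cong)
  finally show ?thesis .
qed

section \<open>Upper and lower bounds for truncated Dirichlet series\<close>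

lemma finite_nat_le_real: "finite {n \<in> A. real n \<le> x}"
  by (rule finite_subset[of _ "{..nat \<lfloor>x\<rfloor>}"]) (auto simp: le_nat_floor)

lemma counting_le:
  assumes "0 \<notin> A" "x \<ge> 0"
  shows "real (counting A x) \<le> x"
proof -
  have "{a \<in> A. real a \<le> x} \<subseteq> {1..nat \<lfloor>x\<rfloor>}"
    using assms(1) by (auto simp: le_nat_floor Suc_le_eq intro!: gr0I)
  from card_mono[OF _ this] have "counting A x \<le> nat \<lfloor>x\<rfloor>"
    by (simp add: counting_def)
  then show ?thesis
    using assms(2) by linarith
qed

text \<open>Below \<open>u\<^sub>0\<close> the count is trivially at most
  \<open>exp u\<^sub>0\<close>, above it \<open>bound\<close> applies, so the sum of the two
  majorants works on all of \<open>{0..}\<close>. The result does not depend on \<open>N\<close>,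
  which permits \<open>N\<close> to tend to infinity later.\<close>

lemma dirichlet_sum_le:
  fixes D \<sigma> t u\<^sub>0 :: real
  assumes "0 \<notin> A" "\<sigma> > 0" "t > 0" "D \<ge> 0" "u\<^sub>0 > 0"
    and bound: "\<And>u. u \<ge> u\<^sub>0 \<Longrightarrow> real (counting A (exp u)) \<le> D * exp u * u powr (t - 1)"
  shows "(\<Sum>a | a \<in> A \<and> a \<le> N. real a powr - (1 + \<sigma>))
           \<le> exp u\<^sub>0 + (1 + \<sigma>) * D * Gamma t * \<sigma> powr - t"
proof -
  define s where "s = 1 + \<sigma>"
  have s: "s > 0" using assms by (simp add: s_def)
  let ?I = "{a \<in> A. a \<le> N}"
  have lhs: "((\<lambda>u. s * exp (- s * u) * (\<Sum>n | n \<in> ?I \<and> ln (real n) \<le> u. 1))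
          has_integral (\<Sum>n\<in>?I. 1 * real n powr - s)) {0..}"
    using s assms(1) by (intro partial_summation_has_integral) auto
  have rhs: "((\<lambda>u. s * exp u\<^sub>0 * exp (- s * u) + s * D * (u powr (t - 1) * exp (- \<sigma> * u)))
          has_integral s * exp u\<^sub>0 * (exp (- s * 0) / s) + s * D * (Gamma t * \<sigma> powr - t)) {0..}"
    using s assms by (intro has_integral_add has_integral_mult_right
        has_integral_exp_minus_to_infinity Gamma_integral_scaled)
  have "s * exp (- s * u) * (\<Sum>n | n \<in> ?I \<and> ln (real n) \<le> u. 1)
      \<le> s * exp u\<^sub>0 * exp (- s * u) + s * D * (u powr (t - 1) * exp (- \<sigma> * u))"
    if "u \<in> {0..}" for u
  proof -
    have "card {n. n \<in> ?I \<and> ln (real n) \<le> u} \<le> counting A (exp u)"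
      unfolding counting_def
    proof (rule card_mono[OF finite_nat_le_real], safe)
      fix n assume "n \<in> A" "ln (real n) \<le> u"
      moreover from this assms(1) have "n > 0" by (metis gr0I)
      ultimately show "real n \<le> exp u"
        by (metis exp_le_cancel_iff exp_ln of_nat_0_less_iff)
    qed
    also have "real \<dots> \<le> exp u\<^sub>0 + D * exp u * u powr (t - 1)"
    proof (cases "u \<ge> u\<^sub>0")
      case True
      then show ?thesis
        using bound[of u] by (smt (verit) exp_gt_zero)
    next
      case False
      then have "real (counting A (exp u)) \<le> exp u\<^sub>0"
        using counting_le[OF assms(1), of "exp u"] by (smt (verit) exp_gt_zero exp_le_cancel_iff)
      moreover have "D * exp u * u powr (t - 1) \<ge> 0"
        using assms by simp
      ultimately show ?thesis by linarith
    qed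
    finally have "s * exp (- s * u) * (\<Sum>n | n \<in> ?I \<and> ln (real n) \<le> u. 1)
        \<le> s * exp (- s * u) * (exp u\<^sub>0 + D * exp u * u powr (t - 1))"
      using s by (intro mult_left_mono) auto
    also have "\<dots> = s * exp u\<^sub>0 * exp (- s * u) + s * D * (u powr (t - 1) * (exp (- s * u) * exp u))"
      by (simp add: algebra_simps)
    \<comment> \<open>The growth \<open>exp u\<close> of the count uses up the 1 in
      \<open>s = 1 + \<sigma>\<close>, leaving the Gamma integrand with parameter
      \<open>\<sigma>\<close>.\<close>
    also have "exp (- s * u) * exp u = exp (- \<sigma> * u)"
      by (simp add: s_def exp_add[symmetric] algebra_simps)
    finally show ?thesis .
  qed
  from has_integral_le[OF lhs rhs this] show ?thesis
    using s by (simp add: s_def mult.assoc)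
qed

text \<open>Truncation at \<open>N\<close> leaves the sums of \<open>f\<close> intact only for
  \<open>u < ln N\<close>, so \<open>bound\<close> is integrated over the window from
  \<open>u\<^sub>0\<close> to \<open>ln N\<close>. The missing tail accounts for the term
  \<open>real N powr - \<sigma>\<close>.\<close>

lemma dirichlet_sum_ge:
  fixes f :: "nat \<Rightarrow> real" and K \<sigma> u\<^sub>0 :: real
  assumes "\<sigma> > 0" "u\<^sub>0 \<ge> 0" "\<And>n. f n \<ge> 0"
    and bound: "\<And>u. u \<ge> u\<^sub>0 \<Longrightarrow> K * exp u \<le> (\<Sum>n | 1 \<le> n \<and> real n \<le> exp u. f n)"
    and N: "exp u\<^sub>0 \<le> real N"
  shows "(1 + \<sigma>) * K * (exp (- \<sigma> * u\<^sub>0) - real N powr - \<sigma>) / \<sigma>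
           \<le> (\<Sum>n = 1..N. f n * real n powr - (1 + \<sigma>))"
proof -
  define s where "s = 1 + \<sigma>"
  have s: "s > 0" using assms by (simp add: s_def)
  have "N > 0" using N by (metis exp_gt_zero not_le of_nat_0 gr0I)
  then have uN: "u\<^sub>0 \<le> ln (real N)"
    using N by (simp add: ln_ge_iff)
  \<comment> \<open>The window is obtained as a difference of two rays:
    \<open>?l u\<^sub>0 - ?l (ln N)\<close> is supported on
    \<open>u\<^sub>0 \<le> u < ln N\<close>.\<close>
  let ?l = "\<lambda>c u. if u \<in> {c..} then s * K * exp (- \<sigma> * u) else 0"
  have l: "(?l c has_integral s * K * (exp (- \<sigma> * c) / \<sigma>)) {0..}" if "c \<ge> 0" for c
  proof -
    have "((\<lambda>u. s * K * exp (- \<sigma> * u)) has_integral s * K * (exp (- \<sigma> * c) / \<sigma>)) {c..}"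
      using assms by (intro has_integral_mult_right has_integral_exp_minus_to_infinity)
    then show ?thesis
      using that by (subst has_integral_restrict) auto
  qed
  have lhs: "((\<lambda>u. ?l u\<^sub>0 u - ?l (ln (real N)) u) has_integral
      s * K * (exp (- \<sigma> * u\<^sub>0) / \<sigma>) - s * K * (exp (- \<sigma> * ln (real N)) / \<sigma>)) {0..}"
    using uN assms(2) by (intro has_integral_diff l) auto
  have rhs: "((\<lambda>u. s * exp (- s * u) * (\<Sum>n | n \<in> {1..N} \<and> ln (real n) \<le> u. f n))
          has_integral (\<Sum>n = 1..N. f n * real n powr - s)) {0..}"
    using s by (intro partial_summation_has_integral) auto
  have "?l u\<^sub>0 u - ?l (ln (real N)) u \<le> s * exp (- s * u) * (\<Sum>n | n \<in> {1..N} \<and> ln (real n) \<le> u. f n)"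
    for u
  proof (cases "u\<^sub>0 \<le> u \<and> u < ln (real N)")
    case True
    have "exp u < real N"
      using True \<open>N > 0\<close> by (metis exp_less_cancel_iff exp_ln of_nat_0_less_iff)
    then have sets: "{n. 1 \<le> n \<and> real n \<le> exp u} = {n. n \<in> {1..N} \<and> ln (real n) \<le> u}"
      using ln_le_cancel_iff[of _ "exp u"] by auto
    have "?l u\<^sub>0 u - ?l (ln (real N)) u = s * K * exp (- \<sigma> * u)"
      using True by auto
    also have "\<dots> = s * K * (exp (- s * u) * exp u)"
      by (simp add: s_def exp_add[symmetric] algebra_simps)
    also have "\<dots> = s * exp (- s * u) * (K * exp u)"
      by simp
    also have "\<dots> \<le> s * exp (- s * u) * (\<Sum>n | 1 \<le> n \<and> real n \<le> exp u. f n)"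
      using s bound True by (intro mult_left_mono) auto
    finally show ?thesis unfolding sets .
  next
    case False
    then have "?l u\<^sub>0 u - ?l (ln (real N)) u = 0"
      using uN by auto
    then show ?thesis
      using s assms(3) by (simp add: sum_nonneg)
  qed
  from has_integral_le[OF lhs rhs this] show ?thesis
    using \<open>N > 0\<close> by (simp add: s_def powr_def algebra_simps diff_divide_distrib)
qed

section \<open>The product of the Dirichlet series\<close>

text \<open>Expand the product into a sum over the finite box \<open>P\<close> of tuples and group
  the tuples by the product of their entries.\<close>

lemma mult_rep_dirichlet_le:
  fixes A :: "nat \<Rightarrow> nat set"
  shows "(\<Sum>n = 1..N. real (mult_rep h A n) * real n powr s)
           \<le> (\<Prod>i = 1..h. \<Sum>a | a \<in> A i \<and> a \<le> N. real a powr s)"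
proof -
  define P where "P = (\<Pi>\<^sub>E i\<in>{1..h}. {a \<in> A i. a \<le> N})"
  define g where "g a = (\<Prod>i = 1..h. real (a i) powr s)" for a
  have fin: "finite P"
    unfolding P_def by (intro finite_PiE) auto
  have "real (mult_rep h A n) * real n powr s = (\<Sum>a\<in>P. if (\<Prod>i = 1..h. a i) = n then g a else 0)"
    if n: "n \<in> {1..N}" for n
  proof -
    \<comment> \<open>Each entry divides \<open>n\<close>, so the box \<open>P\<close> contains
      every tuple counted by \<open>mult_rep h A n\<close> with \<open>n \<le> N\<close>.\<close>
    have "a i \<le> N" if "(\<Prod>i = 1..h. a i) = n" "i \<in> {1..h}" for a i
    proof -
      have "a i dvd n"
        using that by (metis dvd_prodI finite_atLeastAtMost)
      then show ?thesis
        using n by (auto dest: dvd_imp_le)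
    qed
    then have "{a \<in> Pi\<^sub>E {1..h} A. (\<Prod>i = 1..h. a i) = n} = {a \<in> P. (\<Prod>i = 1..h. a i) = n}"
      by (auto simp: P_def PiE_iff)
    then have "real (mult_rep h A n) * real n powr s
        = (\<Sum>a | a \<in> P \<and> (\<Prod>i = 1..h. a i) = n. real n powr s)"
      by (simp add: mult_rep_def)
    also have "\<dots> = (\<Sum>a | a \<in> P \<and> (\<Prod>i = 1..h. a i) = n. g a)"
      by (intro sum.cong) (auto simp: g_def prod_powr_distrib[symmetric])
    also have "\<dots> = (\<Sum>a\<in>P. if (\<Prod>i = 1..h. a i) = n then g a else 0)"
      using fin by (rule sum.inter_filter)
    finally show ?thesis .
  qed
  then have "(\<Sum>n = 1..N. real (mult_rep h A n) * real n powr s)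
      = (\<Sum>n = 1..N. \<Sum>a\<in>P. if (\<Prod>i = 1..h. a i) = n then g a else 0)"
    by (intro sum.cong) auto
  also have "\<dots> = (\<Sum>a\<in>P. if (\<Prod>i = 1..h. a i) \<in> {1..N} then g a else 0)"
    by (subst sum.swap) simp
  \<comment> \<open>Equality fails only through tuples of \<open>P\<close> whose product lies
    outside \<open>{1..N}\<close>; their terms are nonnegative.\<close>
  also have "\<dots> \<le> (\<Sum>a\<in>P. g a)"
    by (intro sum_mono) (auto simp: g_def intro!: prod_nonneg)
  also have "\<dots> = (\<Prod>i = 1..h. \<Sum>a | a \<in> A i \<and> a \<le> N. real a powr s)"
    unfolding P_def g_def by (subst prod_sum_PiE) auto
  finally show ?thesis .
qed

section \<open>From upper limits to bounds in the variable \<open>u = ln x\<close>\<close>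

lemma eventually_at_top_exp:
  assumes "eventually P (at_top :: real filter)"
  obtains u\<^sub>0 :: real where "u\<^sub>0 > 0" "\<And>u. u \<ge> u\<^sub>0 \<Longrightarrow> P (exp u)"
proof -
  have "eventually (\<lambda>u. P (exp u)) at_top"
    using assms exp_at_top by (auto simp: filterlim_iff)
  then obtain c where "\<And>u. u \<ge> c \<Longrightarrow> P (exp u)"
    by (auto simp: eventually_at_top_linorder)
  then show ?thesis
    using that[of "max c 1"] by auto
qed

lemma counting_exp_bound:
  fixes D t :: real
  assumes "scaled_upper_limit A t < ereal D"
  obtains u\<^sub>0 where "u\<^sub>0 > 0" "\<And>u. u \<ge> u\<^sub>0 \<Longrightarrow> real (counting A (exp u)) \<le> D * exp u * u powr (t - 1)"
proof -
  have "eventually (\<lambda>x. real (counting A x) * (ln x powr (1 - t) / x) < D) at_top"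
    using Limsup_lessD[OF assms[unfolded scaled_upper_limit_def]] by simp
  then obtain u\<^sub>0 where u\<^sub>0: "u\<^sub>0 > 0"
    "\<And>u. u \<ge> u\<^sub>0 \<Longrightarrow> real (counting A (exp u)) * (ln (exp u) powr (1 - t) / exp u) < D"
    by (rule eventually_at_top_exp) blast
  have "real (counting A (exp u)) \<le> D * exp u * u powr (t - 1)" if "u \<ge> u\<^sub>0" for u
  proof -
    \<comment> \<open>Positivity matters because \<open>0 powr r = 0\<close>: at
      \<open>u = 0\<close> the two powers below would not cancel to 1.\<close>
    have "u > 0" using that u\<^sub>0(1) by linarith
    have "real (counting A (exp u)) * u powr (1 - t) \<le> D * exp u"
      using u\<^sub>0(2)[OF that] by (simp add: pos_divide_less_eq)
    then have "real (counting A (exp u)) * u powr (1 - t) * u powr (t - 1) \<le> D * exp u * u powr (t - 1)"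
      by (intro mult_right_mono) auto
    moreover have "u powr (1 - t) * u powr (t - 1) = 1"
      using \<open>u > 0\<close> by (simp add: powr_add[symmetric])
    ultimately show ?thesis
      by (simp add: mult.assoc)
  qed
  with u\<^sub>0(1) show ?thesis by (rule that)
qed

text \<open>Excludes the value \<open>-\<infinity>\<close>, so a bounded upper limit is a real
  number, and forces every real \<open>D\<close> above it to be nonnegative.\<close>

lemma scaled_upper_limit_nonneg: "scaled_upper_limit A t \<ge> 0"
proof -
  have "eventually (\<lambda>x::real. ereal (real (counting A x) * (ln x powr (1 - t) / x)) \<ge> 0) at_top"
    using eventually_ge_at_top[of 0] by eventually_elim simp
  then have "Liminf at_top (\<lambda>x::real. ereal (real (counting A x) * (ln x powr (1 - t) / x))) \<ge> 0"
    by (rule Liminf_bounded)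
  also have "\<dots> \<le> scaled_upper_limit A t"
    unfolding scaled_upper_limit_def by (intro Liminf_le_Limsup) simp
  finally show ?thesis .
qed

section \<open>Comparison as \<open>\<sigma>\<close> tends to 0, and the theorem\<close>

text \<open>The strict inequalities for \<open>D\<close> and \<open>K\<close> turn the limits into
  bounds valid from some point on. The two estimates of the Dirichlet series are then compared,
  first letting \<open>N\<close> tend to infinity for fixed \<open>\<sigma>\<close>, then
  \<open>\<sigma>\<close> to 0.\<close>

lemma lower_density_le_prod_Gamma:
  fixes A :: "nat \<Rightarrow> nat set" and \<tau> D :: "nat \<Rightarrow> real" and K :: real
  assumes A: "\<And>i. i \<in> {1..h} \<Longrightarrow> 0 \<notin> A i"
    and \<tau>: "\<And>i. i \<in> {1..h} \<Longrightarrow> 0 < \<tau> i" "(\<Sum>i = 1..h. \<tau> i) = 1"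
    and D: "\<And>i. i \<in> {1..h} \<Longrightarrow> scaled_upper_limit (A i) (\<tau> i) < ereal (D i)"
    and K: "ereal K < Liminf at_top
      (\<lambda>x::real. ereal ((\<Sum>n | 1 \<le> n \<and> real n \<le> x. real (mult_rep h A n)) / x))"
  shows "K \<le> (\<Prod>i = 1..h. D i * Gamma (\<tau> i))"
proof -
  have "eventually (\<lambda>x. K < (\<Sum>n | 1 \<le> n \<and> real n \<le> x. real (mult_rep h A n)) / x) at_top"
    using less_LiminfD[OF K] by simp
  then obtain v where v: "v > 0"
    "\<And>u. u \<ge> v \<Longrightarrow> K < (\<Sum>n | 1 \<le> n \<and> real n \<le> exp u. real (mult_rep h A n)) / exp u"
    by (rule eventually_at_top_exp) blast
  have lower: "K * exp u \<le> (\<Sum>n | 1 \<le> n \<and> real n \<le> exp u. real (mult_rep h A n))" if "u \<ge> v" for u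
    using v(2)[OF that] by (simp add: field_simps)
  have "\<exists>w>0. \<forall>u\<ge>w. real (counting (A i) (exp u)) \<le> D i * exp u * u powr (\<tau> i - 1)"
    if "i \<in> {1..h}" for i
    using counting_exp_bound[OF D[OF that]] by metis
  then obtain w where w: "\<And>i. i \<in> {1..h} \<Longrightarrow> w i > 0"
    "\<And>i u. i \<in> {1..h} \<Longrightarrow> u \<ge> w i \<Longrightarrow>
        real (counting (A i) (exp u)) \<le> D i * exp u * u powr (\<tau> i - 1)"
    by metis
  have D_nonneg: "D i \<ge> 0" if "i \<in> {1..h}" for i
    using D[OF that] scaled_upper_limit_nonneg[of "A i" "\<tau> i"]
    by (metis ereal_less_eq(5) less_imp_le order.trans)
  define M where "M \<sigma> = (\<Prod>i = 1..h. exp (w i) + (1 + \<sigma>) * D i * Gamma (\<tau> i) * \<sigma> powr - \<tau> i)"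
    for \<sigma> :: real
  have finite_N: "(1 + \<sigma>) * K * (exp (- \<sigma> * v) - real N powr - \<sigma>) / \<sigma> \<le> M \<sigma>"
    if "\<sigma> > 0" "exp v \<le> real N" for \<sigma> N
  proof -
    have "(1 + \<sigma>) * K * (exp (- \<sigma> * v) - real N powr - \<sigma>) / \<sigma>
        \<le> (\<Sum>n = 1..N. real (mult_rep h A n) * real n powr - (1 + \<sigma>))"
      using that v(1) lower by (intro dirichlet_sum_ge) auto
    also have "\<dots> \<le> (\<Prod>i = 1..h. \<Sum>a | a \<in> A i \<and> a \<le> N. real a powr - (1 + \<sigma>))"
      by (rule mult_rep_dirichlet_le)
    also have "\<dots> \<le> M \<sigma>"
      unfolding M_def
      using that A \<tau>(1) D_nonneg w by (intro prod_mono conjI sum_nonneg dirichlet_sum_le) auto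
    finally show ?thesis .
  qed
  have "(1 + \<sigma>) * K * (exp (- \<sigma> * v) - 0) / \<sigma> \<le> M \<sigma>" if "\<sigma> > 0" for \<sigma>
  proof (rule tendsto_upperbound)
    have "(\<lambda>N. real N powr - \<sigma>) \<longlonglongrightarrow> 0"
      using that by (intro tendsto_neg_powr filterlim_real_sequentially) auto
    then show "(\<lambda>N. (1 + \<sigma>) * K * (exp (- \<sigma> * v) - real N powr - \<sigma>) / \<sigma>)
        \<longlonglongrightarrow> (1 + \<sigma>) * K * (exp (- \<sigma> * v) - 0) / \<sigma>"
      using that by (intro tendsto_intros) auto
    have "eventually (\<lambda>N. exp v \<le> real N) sequentially"
      using filterlim_real_sequentially by (auto simp: filterlim_at_top)
    then show "eventually (\<lambda>N. (1 + \<sigma>) * K * (exp (- \<sigma> * v) - real N powr - \<sigma>) / \<sigma> \<le> M \<sigma>) sequentially"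
      by eventually_elim (rule finite_N[OF that])
  qed auto
  then have infinite_N: "(1 + \<sigma>) * K * exp (- \<sigma> * v) \<le> \<sigma> * M \<sigma>" if "\<sigma> > 0" for \<sigma>
    using that by (simp add: pos_divide_le_eq mult.commute[of \<sigma> "M \<sigma>"])
  \<comment> \<open>As the \<open>\<tau> i\<close> sum to 1, the factor \<open>\<sigma>\<close>
    splits into the \<open>\<sigma> powr \<tau> i\<close>. Each cancels the singularity of its own
    factor of \<open>M \<sigma>\<close> and makes the bounded part \<open>exp (w i)\<close> vanish
    in the limit.\<close>
  have \<sigma>_M: "\<sigma> * M \<sigma> = (\<Prod>i = 1..h. \<sigma> powr \<tau> i * exp (w i) + (1 + \<sigma>) * D i * Gamma (\<tau> i))"
    if "\<sigma> > 0" for \<sigma>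
  proof -
    have "\<sigma> = (\<Prod>i = 1..h. \<sigma> powr \<tau> i)"
      using that \<tau>(2) by (simp add: powr_sum[symmetric])
    then have "\<sigma> * M \<sigma> = (\<Prod>i = 1..h. \<sigma> powr \<tau> i) * M \<sigma>"
      by simp
    also have "\<dots> = (\<Prod>i = 1..h. \<sigma> powr \<tau> i * exp (w i) + (1 + \<sigma>) * D i * Gamma (\<tau> i))"
      unfolding M_def prod.distrib[symmetric] using that
      by (intro prod.cong refl) (simp add: powr_minus field_simps)
    finally show ?thesis .
  qed
  \<comment> \<open>The zeros stay unsimplified so that both sides have the form in which
    \<open>tendsto_intros\<close> produces the limits.\<close>
  have "(1 + 0) * K * exp (- 0 * v) \<le> (\<Prod>i = 1..h. 0 * exp (w i) + (1 + 0) * D i * Gamma (\<tau> i))"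
  proof (rule tendsto_le)
    show "((\<lambda>\<sigma>. (1 + \<sigma>) * K * exp (- \<sigma> * v)) \<longlongrightarrow> (1 + 0) * K * exp (- 0 * v)) (at_right 0)"
      by (intro tendsto_intros)
    have "((\<lambda>\<sigma>. \<sigma> powr \<tau> i) \<longlongrightarrow> 0) (at_right 0)" if "i \<in> {1..h}" for i
      using \<tau>(1)[OF that] by real_asymp
    then show "((\<lambda>\<sigma>. \<Prod>i = 1..h. \<sigma> powr \<tau> i * exp (w i) + (1 + \<sigma>) * D i * Gamma (\<tau> i)) \<longlongrightarrow>
        (\<Prod>i = 1..h. 0 * exp (w i) + (1 + 0) * D i * Gamma (\<tau> i))) (at_right 0)"
      by (intro tendsto_intros)
    show "eventually (\<lambda>\<sigma>. (1 + \<sigma>) * K * exp (- \<sigma> * v)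
        \<le> (\<Prod>i = 1..h. \<sigma> powr \<tau> i * exp (w i) + (1 + \<sigma>) * D i * Gamma (\<tau> i))) (at_right 0)"
      using eventually_at_right_less[of 0]
      by eventually_elim (use infinite_N \<sigma>_M in metis)
  qed simp
  then show ?thesis by simp
qed

theorem theorem5:
  fixes h :: nat and A :: "nat \<Rightarrow> nat set" and \<tau> :: "nat \<Rightarrow> real"
  assumes "h > 0"
    and "\<And>i. i \<in> {1..h} \<Longrightarrow> A i \<subseteq> {n. n > 0}"
    and "\<And>i. i \<in> {1..h} \<Longrightarrow> 0 < \<tau> i \<and> \<tau> i < 1"
    and "(\<Sum>i = 1..h. \<tau> i) = 1"
    and "\<And>i. i \<in> {1..h} \<Longrightarrow> scaled_upper_limit (A i) (\<tau> i) < \<infinity>"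
  shows "Liminf at_top (\<lambda>x::real. ereal ((\<Sum>n | 1 \<le> n \<and> real n \<le> x. real (mult_rep h A n)) / x))
           * ereal (\<Prod>i = 1..h. 1 / Gamma (\<tau> i))
         \<le> (\<Prod>i = 1..h. scaled_upper_limit (A i) (\<tau> i))"
proof -
  define C where "C i = real_of_ereal (scaled_upper_limit (A i) (\<tau> i))" for i
  have C: "scaled_upper_limit (A i) (\<tau> i) = ereal (C i)" if "i \<in> {1..h}" for i
    using assms(5)[OF that] scaled_upper_limit_nonneg[of "A i" "\<tau> i"] unfolding C_def
    by (cases "scaled_upper_limit (A i) (\<tau> i)") auto
  have Gamma_pos: "Gamma (\<tau> i) > 0" if "i \<in> {1..h}" for i
    using assms(3)[OF that] by (simp add: Gamma_real_pos)
  let ?L = "Liminf at_top (\<lambda>x::real. ereal ((\<Sum>n | 1 \<le> n \<and> real n \<le> x. real (mult_rep h A n)) / x))"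
  have K_le: "K \<le> (\<Prod>i = 1..h. C i * Gamma (\<tau> i))" if K: "ereal K < ?L" for K
  proof -
    \<comment> \<open>The constants must exceed the upper limits strictly, so
      \<open>C i + \<epsilon>\<close> is used and \<open>\<epsilon>\<close> tends to 0 from the
      right.\<close>
    have "K \<le> (\<Prod>i = 1..h. (C i + 0) * Gamma (\<tau> i))"
    proof (rule tendsto_lowerbound)
      show "((\<lambda>\<epsilon>. \<Prod>i = 1..h. (C i + \<epsilon>) * Gamma (\<tau> i)) \<longlongrightarrow> (\<Prod>i = 1..h. (C i + 0) * Gamma (\<tau> i)))
          (at_right 0)"
        by (intro tendsto_intros)
      have "K \<le> (\<Prod>i = 1..h. (C i + \<epsilon>) * Gamma (\<tau> i))" if "\<epsilon> > 0" for \<epsilon>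
        using assms(2-4) C K that by (intro lower_density_le_prod_Gamma[where A = A]) auto
      then show "eventually (\<lambda>\<epsilon>. K \<le> (\<Prod>i = 1..h. (C i + \<epsilon>) * Gamma (\<tau> i))) (at_right 0)"
        using eventually_at_right_less[of 0] by (auto elim: eventually_mono)
    qed simp
    then show ?thesis by simp
  qed
  \<comment> \<open>A real \<open>K\<close> strictly between the two sides would contradict
    \<open>K_le\<close>; this also covers an infinite \<open>?L\<close>.\<close>
  have "?L \<le> ereal (\<Prod>i = 1..h. C i * Gamma (\<tau> i))"
  proof (rule ccontr)
    assume "\<not> ?thesis"
    then have "ereal (\<Prod>i = 1..h. C i * Gamma (\<tau> i)) < ?L"
      by (simp only: not_le)
    then obtain K where "ereal (\<Prod>i = 1..h. C i * Gamma (\<tau> i)) < ereal K" "ereal K < ?L"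
      using ereal_dense2 by blast
    with K_le[of K] show False by simp
  qed
  moreover have "(\<Prod>i = 1..h. 1 / Gamma (\<tau> i)) \<ge> 0"
    using Gamma_pos by (intro prod_nonneg) (simp add: less_imp_le)
  ultimately have "?L * ereal (\<Prod>i = 1..h. 1 / Gamma (\<tau> i))
      \<le> ereal (\<Prod>i = 1..h. C i * Gamma (\<tau> i)) * ereal (\<Prod>i = 1..h. 1 / Gamma (\<tau> i))"
    by (intro ereal_mult_right_mono) auto
  also have "\<dots> = ereal (\<Prod>i = 1..h. C i * Gamma (\<tau> i) * (1 / Gamma (\<tau> i)))"
    by (simp only: times_ereal.simps prod.distrib)
  also have "(\<Prod>i = 1..h. C i * Gamma (\<tau> i) * (1 / Gamma (\<tau> i))) = (\<Prod>i = 1..h. C i)"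
    by (intro prod.cong refl) (use Gamma_pos in force)
  also have "ereal \<dots> = (\<Prod>i = 1..h. scaled_upper_limit (A i) (\<tau> i))"
    by (simp add: C prod_ereal[symmetric])
  finally show ?thesis .
qed

end
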